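(* Let $d\ge1$ and let $(\mathcal{F}_n)_{n\ge0}$ be a filtration. Let $\mathbf{B}_n^*=(B_{n,1}^*,\dots,B_{n,d}^* )$, $n\ge1$, be random vectors with nonnegative entries (base bets), predictable with respect to $(\mathcal{F}_n)_{n\ge0}$. For $n\ge1$ let $\mathbf{B}_n^\circ=(B_{n,1}^\circ,\dots,B_{n,d}^\circ)$, $\mathbf{R}_n^\circ=(R_{n,1}^\circ,\dots,R_{n,d}^\circ)$, $\mathbf{X}_n^\circ=(X_{n,1}^\circ,\dots,X_{n,d}^\circ)$, where $B_{n,j}^\circ\ge1$ is a one-unit base bet plus any subsequent bet made on the $j$th betting opportunity at the $n$th coup, $R_{n,j}^\circ\ge0$ is the return from the bet of $B_{n,j}^\circ$, and $X_{n,j}^\circ=R_{n,j}^\circ-B_{n,j}^\circ$ is the profit from it. Assume that each of the sequences $(\mathbf{B}_n^\circ,\mathbf{R}_n^\circ)_{n\ge1}$ and $(\mathbf{B}_n^\circ,\mathbf{X}_n^\circ)_{n\ge1}$ is i.i.d. in $n$ and adapted to $(\mathcal{F}_n)_{n\ge0}$, with $(\mathbf{B}_n^\circ,\mathbf{R}_n^\circ)$ independent of $\mathcal{F}_{n-1}$ and $(\mathbf{B}_n^\circ,\mathbf{X}_n^\circ)$ independent of $\mathcal{F}_{n-1}$ for each $n\ge1$. Put $B_n=\mathbf{B}_n^*\cdot\mathbf{B}_n^\circ$, $R_n=\mathbf{B}_n^*\cdot\mathbf{R}_n^\circ$, $X_n=\mathbf{B}_n^*\cdot\mathbf{X}_n^\circ$,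 and $$\mathfrak{R}_n:=\frac{\sum_{k=1}^n R_k}{\sum_{k=1}^n B_k},\qquad \mathfrak{X}_n:=\frac{\sum_{k=1}^n X_k}{\sum_{k=1}^n B_k}.$$ Suppose that $$\sup_{n\ge1}\mathbb{E}[|\mathbf{B}_n^*|^2]<\infty,\qquad\liminf_{n\to\infty}\frac1n\sum_{k=1}^n\mathbf{B}_k^*\cdot\mathbf{B}_k^\circ>0\quad\text{a.s.},\qquad\text{and}\qquad\mathbb{E}[|\mathbf{B}_1^\circ|^2]<\infty.$$ If $\mathbb{E}[|\mathbf{R}_1^\circ|^2]<\infty$, or equivalently $\mathbb{E}[|\mathbf{X}_1^\circ|^2]<\infty$, then, almost surely, $$\min_{1\le i\le d}\mathrm{RTP}(B_{1,i}^\circ,R_{1,i}^\circ)\le\liminf_{n\to\infty}\frac{\sum_{k=1}^n\mathbf{B}_k^*\cdot\mathbb{E}[\mathbf{R}_1^\circ]}{\sum_{k=1}^n\mathbf{B}_k^*\cdot\mathbb{E}[\mathbf{B}_1^\circ]}=\liminf_{n\to\infty}\mathfrak{R}_n\le\limsup_{n\to\infty}\mathfrak{R}_n=\limsup_{n\to\infty}\frac{\sum_{k=1}^n\mathbf{B}_k^*\cdot\mathbb{E}[\mathbf{R}_1^\circ]}{\sum_{k=1}^n\mathbf{B}_k^*\cdot\mathbb{E}[\mathbf{B}_1^\circ]}\le\max_{1\le i\le d}\mathrm{RTP}(B_{1,i}^\circ,R_{1,i}^\circ)$$ and $$-\max_{1\le i\le d}\mathrm{HA}(B_{1,i}^\circ,X_{1,i}^\circ)\le\liminf_{n\to\infty}\frac{\sum_{k=1}^n\mathbf{B}_k^*\cdot\mathbb{E}[\mathbf{X}_1^\circ]}{\sum_{k=1}^n\mathbf{B}_k^*\cdot\mathbb{E}[\mathbf{B}_1^\circ]}=\liminf_{n\to\infty}\mathfrak{X}_n\le\limsup_{n\to\infty}\mathfrak{X}_n=\limsup_{n\to\infty}\frac{\sum_{k=1}^n\mathbf{B}_k^*\cdot\mathbb{E}[\mathbf{X}_1^\circ]}{\sum_{k=1}^n\mathbf{B}_k^*\cdot\mathbb{E}[\mathbf{B}_1^\circ]}\le-\min_{1\le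 i\le d}\mathrm{HA}(B_{1,i}^\circ,X_{1,i}^\circ).$$ The limits exist under either of two additional conditions: (i) If $\mathrm{RTP}(B_{1,1}^\circ,R_{1,1}^\circ)=\cdots=\mathrm{RTP}(B_{1,d}^\circ,R_{1,d}^\circ)$, or equivalently $\mathrm{HA}(B_{1,1}^\circ,X_{1,1}^\circ)=\cdots=\mathrm{HA}(B_{1,d}^\circ,X_{1,d}^\circ)$, then $\lim_{n\to\infty}\mathfrak{R}_n=\mathrm{RTP}(B_{1,1}^\circ,R_{1,1}^\circ)$ a.s. and $\lim_{n\to\infty}\mathfrak{X}_n=-\mathrm{HA}(B_{1,1}^\circ,X_{1,1}^\circ)$ a.s. (ii) If $\lim_{n\to\infty}\sum_{k=1}^n\mathbf{B}_k^*\big/\sum_{k=1}^n\mathbf{B}_k^*\cdot\mathbf{1}=\mathbf{w}$ a.s., where $\mathbf{w}=(w_1,\dots,w_d)$, then $$\lim_{n\to\infty}\mathfrak{R}_n=\frac{\sum_{i=1}^d w_i\,\mathbb{E}[B_{1,i}^\circ]\,\mathrm{RTP}(B_{1,i}^\circ,R_{1,i}^\circ)}{\sum_{i=1}^d w_i\,\mathbb{E}[B_{1,i}^\circ]}\quad\text{a.s.}$$ and $$\lim_{n\to\infty}\mathfrak{X}_n=-\frac{\sum_{i=1}^d w_i\,\mathbb{E}[B_{1,i}^\circ]\,\mathrm{HA}(B_{1,i}^\circ,X_{1,i}^\circ)}{\sum_{i=1}^d w_i\,\mathbb{E}[B_{1,i}^\circ]}\quad\text{a.s.}$$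
   Context: All random variables live on a common probability space. $\mathcal{F}_n$ is interpreted as the $\sigma$-algebra of all events known following the $n$th coup; $d$ is the number of betting opportunities per coup. Predictable means $\mathbf{B}_n^*$ is $\mathcal{F}_{n-1}$-measurable for every $n\ge1$. $\mathbf{1}=(1,\dots,1)\in\mathbb{R}^d$, $\cdot$ is the dot product, $|\cdot|$ is the Euclidean norm, and expectations of vectors are entrywise. For fixed $n$, the components indexed by $j=1,\dots,d$ need be neither independent nor identically distributed. For a bet $B\ge0$, return $R\ge0$, and profit $X=R-B$, with $0<\mathbb{E}[B]<\infty$, $\mathbb{E}[R]<\infty$, $\mathbb{E}[|X|]<\infty$, $$\mathrm{RTP}(B,R):=\frac{\mathbb{E}[R]}{\mathbb{E}[B]},\qquad \mathrm{HA}(B,X):=-\frac{\mathbb{E}[X]}{\mathbb{E}[B]}.$$ Ratios are considered for $n$ large enough that the denominator is positive (which holds eventually, almost surely). *)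

theory Defs
  imports "HOL-Probability.Probability"
begin

text \<open>
  Random sequences are indexed by \<open>nat\<close>, but only the terms with index \<open>n \<ge> 1\<close> (the coups) carry
  any meaning; index \<open>0\<close> is used for the filtration alone.  The \<open>d\<close> betting opportunities are the
  elements of a finite type \<open>'d\<close>, so \<open>d = CARD('d) \<ge> 1\<close>.
\<close>

definition filtration_of :: "'a measure \<Rightarrow> (nat \<Rightarrow> 'a measure) \<Rightarrow> bool" where
  "filtration_of M F \<longleftrightarrow> filtration (space M) F \<and> (\<forall>n. subalgebra M (F n))"

definition predictable ::
    "(nat \<Rightarrow> 'a measure) \<Rightarrow> (nat \<Rightarrow> 'a \<Rightarrow> 'b::topological_space) \<Rightarrow> bool" where
  "predictable F Z \<longleftrightarrow> (\<forall>n\<ge>1. Z n \<in> borel_measurable (F (n - 1)))"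

definition adapted ::
    "(nat \<Rightarrow> 'a measure) \<Rightarrow> (nat \<Rightarrow> 'a \<Rightarrow> 'b::topological_space) \<Rightarrow> bool" where
  "adapted F Z \<longleftrightarrow> (\<forall>n\<ge>1. Z n \<in> borel_measurable (F n))"

context prob_space
begin

definition iid :: "(nat \<Rightarrow> 'a \<Rightarrow> 'b::topological_space) \<Rightarrow> bool" where
  "iid Z \<longleftrightarrow> indep_vars (\<lambda>_. borel) Z {1..} \<and>
     (\<forall>n\<ge>1. distr M borel (Z n) = distr M borel (Z 1))"

definition indep_of_past ::
    "(nat \<Rightarrow> 'a measure) \<Rightarrow> (nat \<Rightarrow> 'a \<Rightarrow> 'b::topological_space) \<Rightarrow> bool" where
  "indep_of_past F Z \<longleftrightarrow>
     (\<forall>n\<ge>1. indep_set {Z n -` A \<inter> space M | A. A \<in> sets borel} (sets (F (n - 1))))"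

end

definition mean_vec :: "'a measure \<Rightarrow> ('a \<Rightarrow> real ^ 'd) \<Rightarrow> real ^ 'd" where
  "mean_vec M V = (\<chi> j. \<integral>\<omega>. V \<omega> $ j \<partial>M)"

text \<open>The second moment \<open>E[|V|\<^sup>2]\<close>, as an extended nonnegative number.\<close>

definition second_moment :: "'a measure \<Rightarrow> ('a \<Rightarrow> real ^ 'd) \<Rightarrow> ennreal" where
  "second_moment M V = (\<integral>\<^sup>+\<omega>. ennreal ((norm (V \<omega>))\<^sup>2) \<partial>M)"

definition RTP :: "'a measure \<Rightarrow> ('a \<Rightarrow> real) \<Rightarrow> ('a \<Rightarrow> real) \<Rightarrow> real" where
  "RTP M B R = (\<integral>\<omega>. R \<omega> \<partial>M) / (\<integral>\<omega>. B \<omega> \<partial>M)"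

definition HA :: "'a measure \<Rightarrow> ('a \<Rightarrow> real) \<Rightarrow> ('a \<Rightarrow> real) \<Rightarrow> real" where
  "HA M B X = - ((\<integral>\<omega>. X \<omega> \<partial>M) / (\<integral>\<omega>. B \<omega> \<partial>M))"

text \<open>
  If the denominator vanishes the value is \<open>0\<close> by convention; this concerns only finitely many \<open>n\<close>
  almost surely in the uses below, hence affects neither limits nor lower or upper limits.
\<close>

definition cum_ratio ::
    "(nat \<Rightarrow> 'a \<Rightarrow> real) \<Rightarrow> (nat \<Rightarrow> 'a \<Rightarrow> real) \<Rightarrow> nat \<Rightarrow> 'a \<Rightarrow> real" where
  "cum_ratio U V n \<omega> = (\<Sum>k=1..n. U k \<omega>) / (\<Sum>k=1..n. V k \<omega>)"

end

theory Submission
  imports Defs "HOL-Library.Discrete_Functions"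
begin

text \<open>
  Each coordinate of \<open>B\<^sub>k\<^sup>* (V\<^sub>k - E V\<^sub>1)\<close>, for \<open>V = B, R, X\<close>, is a martingale difference
  with bounded second moment, so the averages of \<open>B\<^sub>k\<^sup>* \<bullet> V\<^sub>k\<close> and \<open>B\<^sub>k\<^sup>* \<bullet> E V\<^sub>1\<close> differ by a null
  sequence almost surely.  As the average bet stays bounded away from \<open>0\<close>, the ratio of cumulative sums
  has the same lower and upper limit as the ratio in which \<open>V\<^sub>k\<close> and \<open>B\<^sub>k\<close> are replaced by their
  means; and the latter is a weighted average of the numbers \<open>E V\<^sub>1\<^sub>,\<^sub>i / E B\<^sub>1\<^sub>,\<^sub>i\<close>.
\<close>

subsection \<open>A strong law for orthogonal random variables\<close>

text \<open>The hypotheses keep the average bet away from 0, but bounded second moments do not keep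
  the averages of the base bets bounded above along a path. So numerator and denominator, each
  divided by n, need not converge or even stay bounded, and the two quotients have to be compared
  directly. What makes this possible is that the quotient of means is bounded by a constant, so that
  an error in the denominator is multiplied by a bounded factor only. No conditional expectation is
  formed: a factor known before coup k is independent of the outcome of coup k, so the expectation
  of their product splits, and a centred outcome makes it vanish. Return and profit enter in the
  same way, hence the numerator is treated for a general sequence \<open>V\<close>, and each of the
  two chains is an instance.\<close>

lemma integrable_mult_of_squares:
  fixes f g :: "'a \<Rightarrow> real"
  assumes [measurable]: "f \<in> borel_measurable M" "g \<in> borel_measurable M"
    and "integrable M (\<lambda>x. (f x)\<^sup>2)" "integrable M (\<lambda>x. (g x)\<^sup>2)"
  shows "integrable M (\<lambda>x. f x * g x)"
proof (rule Bochner_Integration.integrable_bound)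
  show "integrable M (\<lambda>x. (f x)\<^sup>2 + (g x)\<^sup>2)"
    using assms by simp
  have "\<bar>a * b\<bar> \<le> a\<^sup>2 + b\<^sup>2" for a b :: real
    using sum_squares_bound[of "\<bar>a\<bar>" "\<bar>b\<bar>"] mult_nonneg_nonneg[of "\<bar>a\<bar>" "\<bar>b\<bar>"]
    unfolding abs_mult power2_abs mult.assoc by linarith
  then show "AE x in M. norm (f x * g x) \<le> norm ((f x)\<^sup>2 + (g x)\<^sup>2)"
    by simp
qed measurable

text \<open>By monotone convergence the sum of the series has finite integral, so the series
  converges almost everywhere and its terms vanish in the limit. This takes the place of Chebyshev's
  inequality combined with Borel-Cantelli.\<close>

lemma AE_tendsto_0_of_summable_integrals:
  fixes f :: "nat \<Rightarrow> 'a \<Rightarrow> real"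
  assumes f: "\<And>n. integrable M (f n)" and nonneg: "\<And>n x. 0 \<le> f n x"
    and sum: "summable (\<lambda>n. \<integral>x. f n x \<partial>M)"
  shows "AE x in M. (\<lambda>n. f n x) \<longlonglongrightarrow> 0"
proof -
  have [measurable]: "f n \<in> borel_measurable M" for n
    using f by auto
  have "(\<integral>\<^sup>+x. (\<Sum>n. ennreal (f n x)) \<partial>M) = (\<Sum>n. \<integral>\<^sup>+x. ennreal (f n x) \<partial>M)"
    by (rule nn_integral_suminf) measurable
  also have "\<dots> = (\<Sum>n. ennreal (\<integral>x. f n x \<partial>M))"
    by (simp add: nn_integral_eq_integral f nonneg)
  also have "\<dots> \<noteq> \<infinity>"
    by (subst suminf_ennreal2) (auto simp: sum nonneg intro: integral_nonneg_AE)
  finally have "AE x in M. (\<Sum>n. ennreal (f n x)) \<noteq> \<infinity>"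
    by (intro nn_integral_PInf_AE) auto
  then show ?thesis
  proof eventually_elim
    case (elim x)
    have "summable (\<lambda>n. f n x)"
      by (rule summable_suminf_not_top) (use elim nonneg in auto)
    then show ?case
      by (rule summable_LIMSEQ_zero)
  qed
qed

text \<open>The mixed terms of the expanded square have expectation 0, so only the diagonal
  survives. The index set is an arbitrary finite set because both initial segments and pieces of a
  block are needed.\<close>

lemma (in prob_space) expectation_square_orthogonal_sum:
  fixes D :: "nat \<Rightarrow> 'a \<Rightarrow> real" and C :: real
  assumes [measurable]: "\<And>k. D k \<in> borel_measurable M"
    and sq: "\<And>k. integrable M (\<lambda>\<omega>. (D k \<omega>)\<^sup>2)"
    and bound: "\<And>k. expectation (\<lambda>\<omega>. (D k \<omega>)\<^sup>2) \<le> C"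
    and orth: "\<And>j k. j < k \<Longrightarrow> expectation (\<lambda>\<omega>. D j \<omega> * D k \<omega>) = 0"
    and A: "finite A"
  shows "integrable M (\<lambda>\<omega>. (\<Sum>k\<in>A. D k \<omega>)\<^sup>2)"
    and "expectation (\<lambda>\<omega>. (\<Sum>k\<in>A. D k \<omega>)\<^sup>2) \<le> card A * C"
proof -
  have int: "integrable M (\<lambda>\<omega>. D j \<omega> * D k \<omega>)" for j k
    by (intro integrable_mult_of_squares sq) measurable
  have eq: "(\<Sum>k\<in>A. D k \<omega>)\<^sup>2 = (\<Sum>j\<in>A. \<Sum>k\<in>A. D j \<omega> * D k \<omega>)" for \<omega>
    by (simp add: power2_eq_square sum_product)
  show "integrable M (\<lambda>\<omega>. (\<Sum>k\<in>A. D k \<omega>)\<^sup>2)"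
    unfolding eq using int by (intro Bochner_Integration.integrable_sum)
  have orth': "expectation (\<lambda>\<omega>. D j \<omega> * D k \<omega>) = (if j = k then expectation (\<lambda>\<omega>. (D j \<omega>)\<^sup>2) else 0)" for j k
    using orth[of j k] orth[of k j] by (cases j k rule: linorder_cases) (auto simp: power2_eq_square mult.commute)
  have "expectation (\<lambda>\<omega>. (\<Sum>k\<in>A. D k \<omega>)\<^sup>2) = (\<Sum>j\<in>A. \<Sum>k\<in>A. expectation (\<lambda>\<omega>. D j \<omega> * D k \<omega>))"
    unfolding eq using int by (simp add: Bochner_Integration.integral_sum Bochner_Integration.integrable_sum)
  also have "\<dots> = (\<Sum>j\<in>A. expectation (\<lambda>\<omega>. (D j \<omega>)\<^sup>2))"
    unfolding orth' using A by (simp add: sum.delta)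
  also have "\<dots> \<le> card A * C"
    using sum_bounded_above[of A _ C] bound by simp
  finally show "expectation (\<lambda>\<omega>. (\<Sum>k\<in>A. D k \<omega>)\<^sup>2) \<le> card A * C" .
qed

text \<open>
  Along the squares the second moments of the averages are summable, and within a block
  \<open>[N\<^sup>2, (N + 1)\<^sup>2)\<close> even the sum of all squared increments has expectation \<open>O(N\<^sup>2)\<close>; so no
  maximal inequality is needed.
\<close>

lemma (in prob_space) orthogonal_SLLN:
  fixes D :: "nat \<Rightarrow> 'a \<Rightarrow> real"
  assumes [measurable]: "\<And>k. D k \<in> borel_measurable M"
    and sq: "\<And>k. integrable M (\<lambda>\<omega>. (D k \<omega>)\<^sup>2)"
    and bound: "\<And>k. expectation (\<lambda>\<omega>. (D k \<omega>)\<^sup>2) \<le> C"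
    and orth: "\<And>j k. j < k \<Longrightarrow> expectation (\<lambda>\<omega>. D j \<omega> * D k \<omega>) = 0"
  shows "AE \<omega> in M. (\<lambda>n. (\<Sum>k<n. D k \<omega>) / real n) \<longlonglongrightarrow> 0"
proof -
  note sum_sq = expectation_square_orthogonal_sum[of D C, OF assms]
  have "0 \<le> expectation (\<lambda>\<omega>. (D 0 \<omega>)\<^sup>2)"
    by (rule integral_nonneg_AE) simp
  with bound[of 0] have C: "0 \<le> C" by linarith
  \<comment> \<open>One quantity controls the sum up to the square and every partial sum inside the
    block. The divisor is the square of the time \<open>N\<^sup>2\<close>, as the sums are
    squared.\<close>
  define f where "f N \<omega> = ((\<Sum>k<N\<^sup>2. D k \<omega>)\<^sup>2 + (\<Sum>m=N\<^sup>2..<(N+1)\<^sup>2. (\<Sum>k=N\<^sup>2..<m. D k \<omega>)\<^sup>2)) / real N ^ 4"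
    for N \<omega>
  have f_int: "integrable M (f N)" for N
    unfolding f_def using sum_sq by (intro integrable_divide Bochner_Integration.integrable_add Bochner_Integration.integrable_sum) auto
  have f_nonneg: "0 \<le> f N \<omega>" for N \<omega>
    unfolding f_def by (intro divide_nonneg_nonneg add_nonneg_nonneg sum_nonneg) auto
  \<comment> \<open>For \<open>N = 0\<close> both sides are 0, since division by 0 gives 0.
    Otherwise the block has 2N + 1 elements, and each of its 2N + 1 partial sums has at most that
    many terms.\<close>
  have f_le: "expectation (f N) \<le> 10 * C * (1 / real N ^ 2)" for N
  proof (cases "N = 0")
    case False
    then have N: "1 \<le> real N" by simp
    have card: "card {N\<^sup>2..<(N+1)\<^sup>2} = 2 * N + 1"
      by (simp add: power2_eq_square)
    have "expectation (f N) = (expectation (\<lambda>\<omega>. (\<Sum>k<N\<^sup>2. D k \<omega>)\<^sup>2) +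
        (\<Sum>m=N\<^sup>2..<(N+1)\<^sup>2. expectation (\<lambda>\<omega>. (\<Sum>k=N\<^sup>2..<m. D k \<omega>)\<^sup>2))) / real N ^ 4"
      unfolding f_def using sum_sq
      by (simp add: Bochner_Integration.integral_sum Bochner_Integration.integral_add Bochner_Integration.integrable_sum)
    also have "\<dots> \<le> (real (N\<^sup>2) * C + (\<Sum>m=N\<^sup>2..<(N+1)\<^sup>2. (2 * real N + 1) * C)) / real N ^ 4"
    proof (intro divide_right_mono add_mono sum_mono)
      show "expectation (\<lambda>\<omega>. (\<Sum>k<N\<^sup>2. D k \<omega>)\<^sup>2) \<le> real (N\<^sup>2) * C"
        using sum_sq(2)[of "{..<N\<^sup>2}"] by simp
      fix m :: nat assume m: "m \<in> {N\<^sup>2..<(N+1)\<^sup>2}"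
      have "card {N\<^sup>2..<m} \<le> 2 * N + 1"
        using m by (auto simp: power2_eq_square)
      then have le: "real (card {N\<^sup>2..<m}) \<le> real (2 * N + 1)"
        by (rule of_nat_mono)
      have "expectation (\<lambda>\<omega>. (\<Sum>k=N\<^sup>2..<m. D k \<omega>)\<^sup>2) \<le> card {N\<^sup>2..<m} * C"
        using sum_sq(2)[of "{N\<^sup>2..<m}"] by simp
      also have "\<dots> \<le> real (2 * N + 1) * C"
        by (rule mult_right_mono[OF le C])
      finally show "expectation (\<lambda>\<omega>. (\<Sum>k=N\<^sup>2..<m. D k \<omega>)\<^sup>2) \<le> (2 * real N + 1) * C"
        by (simp add: add.commute)
    qed simp
    also have "(\<Sum>m=N\<^sup>2..<(N+1)\<^sup>2. (2 * real N + 1) * C) = (2 * real N + 1) * ((2 * real N + 1) * C)"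
      by (simp only: sum_constant card) simp
    also have "(real (N\<^sup>2) * C + \<dots>) / real N ^ 4 = C * ((real N)\<^sup>2 + (2 * real N + 1)\<^sup>2) / real N ^ 4"
      by (simp add: power2_eq_square algebra_simps)
    also have "\<dots> \<le> C * (10 * (real N)\<^sup>2) / real N ^ 4"
    proof (intro divide_right_mono mult_left_mono C)
      \<comment> \<open>Here N is at least 1, so 2N + 1 is at most 3N; the constant 10 is 9 +
        1.\<close>
      have "(2 * real N + 1)\<^sup>2 \<le> (3 * real N)\<^sup>2"
        using N by (intro power_mono) auto
      then show "(real N)\<^sup>2 + (2 * real N + 1)\<^sup>2 \<le> 10 * (real N)\<^sup>2"
        by (simp add: power_mult_distrib)
    qed simp
    also have "\<dots> = 10 * C * (1 / real N ^ 2)"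
      using False by (simp add: field_simps eval_nat_numeral)
    finally show ?thesis .
  qed (simp add: f_def[abs_def])
  have "summable (\<lambda>N. expectation (f N))"
  proof (rule summable_comparison_test')
    show "summable (\<lambda>N. 10 * C * (1 / real N ^ 2))"
      using inverse_power_summable[of 2, where 'a = real]
      by (intro summable_mult) (simp add: field_simps)
    show "norm (expectation (f N)) \<le> 10 * C * (1 / real N ^ 2)" for N
      using f_le[of N] integral_nonneg_AE[of "f N" M] f_nonneg by auto
  qed
  then have "AE \<omega> in M. (\<lambda>N. f N \<omega>) \<longlonglongrightarrow> 0"
    using f_int f_nonneg by (intro AE_tendsto_0_of_summable_integrals)
  then show ?thesis
  proof eventually_elim
    case (elim \<omega>)
    have filt: "filterlim floor_sqrt at_top sequentially"
      unfolding filterlim_at_top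
    proof
      show "eventually (\<lambda>n. Z \<le> floor_sqrt n) sequentially" for Z
        using eventually_ge_at_top[of "Z\<^sup>2"] by eventually_elim (simp add: le_floor_sqrtI)
    qed
    have "(\<lambda>n. 2 * sqrt (f (floor_sqrt n) \<omega>)) \<longlonglongrightarrow> 2 * sqrt 0"
      using filterlim_compose[OF elim filt] by (intro tendsto_intros)
    then have lim: "(\<lambda>n. 2 * sqrt (f (floor_sqrt n) \<omega>)) \<longlonglongrightarrow> 0"
      by simp
    show ?case
    proof (rule Lim_null_comparison[OF _ lim])
      show "eventually (\<lambda>n. norm ((\<Sum>k<n. D k \<omega>) / real n) \<le> 2 * sqrt (f (floor_sqrt n) \<omega>)) sequentially"
        using eventually_gt_at_top[of 0]
      proof eventually_elim
        case (elim n)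
        \<comment> \<open>\<open>N\<close> is the number of the block that contains
          \<open>n\<close>; it is positive because \<open>n\<close> is.\<close>
        define N where "N = floor_sqrt n"
        have N: "N\<^sup>2 \<le> n" "n < (N+1)\<^sup>2" "0 < N"
          using elim Suc_floor_sqrt_power2_gt[of n] by (auto simp: N_def)
        define a where "a = (\<Sum>k<N\<^sup>2. D k \<omega>)"
        define b where "b = (\<Sum>k=N\<^sup>2..<n. D k \<omega>)"
        have ab: "(\<Sum>k<n. D k \<omega>) = a + b"
          unfolding a_def b_def lessThan_atLeast0 using N by (intro sum.atLeastLessThan_concat[symmetric]) auto
        \<comment> \<open>Since \<open>n\<close> lies in the block, the square of \<open>b\<close>
          is one of the summands for the block.\<close>
        have "b\<^sup>2 \<le> (\<Sum>m=N\<^sup>2..<(N+1)\<^sup>2. (\<Sum>k=N\<^sup>2..<m. D k \<omega>)\<^sup>2)"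
          unfolding b_def using N by (intro member_le_sum) auto
        then have le: "(a\<^sup>2 + b\<^sup>2) / real N ^ 4 \<le> f N \<omega>"
          unfolding f_def a_def by (intro divide_right_mono) auto
        have "\<bar>a\<bar> / (real N)\<^sup>2 = sqrt (a\<^sup>2 / real N ^ 4)" "\<bar>b\<bar> / (real N)\<^sup>2 = sqrt (b\<^sup>2 / real N ^ 4)"
          by (simp_all add: real_sqrt_divide real_sqrt_power_even power2_eq_square[of "real N"] real_sqrt_mult eval_nat_numeral)
        moreover have "sqrt (a\<^sup>2 / real N ^ 4) \<le> sqrt (f N \<omega>)" "sqrt (b\<^sup>2 / real N ^ 4) \<le> sqrt (f N \<omega>)"
          using le by (auto simp: add_divide_distrib intro!: real_sqrt_le_mono order_trans[OF _ le])
        ultimately have "(\<bar>a\<bar> + \<bar>b\<bar>) / (real N)\<^sup>2 \<le> 2 * sqrt (f N \<omega>)"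
          unfolding add_divide_distrib by linarith
        \<comment> \<open>Replacing the divisor \<open>n\<close> by the smaller
          \<open>N\<^sup>2\<close> only enlarges the bound.\<close>
        moreover have "\<bar>a + b\<bar> / real n \<le> (\<bar>a\<bar> + \<bar>b\<bar>) / (real N)\<^sup>2"
          using N by (intro frac_le) (auto simp flip: of_nat_power)
        ultimately show ?case
          unfolding ab N_def by (simp add: abs_divide)
      qed
    qed
  qed
qed

subsection \<open>Martingale transforms\<close>

text \<open>\<open>indep_var\<close> speaks of generated sigma-algebras, whereas the hypothesis
  speaks of preimages. Preimages of Borel sets are closed under intersection, so independence
  extends from them to what they generate; and the preimages under \<open>f\<close> are events of
  the past.\<close>

lemma (in prob_space) indep_of_past_imp_indep_var:
  fixes Z :: "nat \<Rightarrow> 'a \<Rightarrow> 'b::topological_space" and f :: "'a \<Rightarrow> 'b"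
  assumes F: "filtration_of M F" and "indep_of_past F Z" and n: "n \<ge> 1"
    and Z: "Z n \<in> borel_measurable M" and f: "f \<in> borel_measurable (F (n - 1))"
  shows "indep_var borel f borel (Z n)"
  unfolding indep_var_eq
proof (intro conjI indep_set_sigma_sets)
  have sub: "subalgebra M (F (n - 1))"
    using F by (simp add: filtration_of_def)
  then show "random_variable borel f"
    using f by (rule measurable_from_subalg)
  have indep: "indep_set {Z n -` A \<inter> space M |A. A \<in> sets borel} (sets (F (n - 1)))"
    using \<open>indep_of_past F Z\<close> n unfolding indep_of_past_def by blast
  have f_sets: "f -` A \<inter> space M \<in> sets (F (n - 1))" if "A \<in> sets borel" for A
    using measurable_sets[OF f that] sub by (simp add: subalgebra_def)
  show "indep_set {f -` A \<inter> space M |A. A \<in> sets borel} {Z n -` A \<inter> space M |A. A \<in> sets borel}"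
  proof (rule indep_setI)
    show "{Z n -` A \<inter> space M |A. A \<in> sets borel} \<subseteq> events"
      using indep unfolding indep_sets2_eq by (rule conjunct1)
    show "{f -` A \<inter> space M |A. A \<in> sets borel} \<subseteq> events"
    proof safe
      fix A :: "'b set" assume "A \<in> sets borel"
      then show "f -` A \<inter> space M \<in> events"
        using f_sets sub unfolding subalgebra_def by blast
    qed
    fix a b assume a: "a \<in> {f -` A \<inter> space M |A. A \<in> sets borel}"
      and b: "b \<in> {Z n -` A \<inter> space M |A. A \<in> sets borel}"
    from a f_sets have "a \<in> sets (F (n - 1))"
      by blast
    with b have "prob (b \<inter> a) = prob b * prob a"
      by (rule indep_setD[OF indep])
    then show "prob (a \<inter> b) = prob a * prob b"
      by (simp add: Int_commute mult.commute)
  qed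
  show "Int_stable {g -` A \<inter> space M |A. A \<in> sets borel}" for g :: "'a \<Rightarrow> 'd::topological_space"
    unfolding Int_stable_def
  proof safe
    fix A B :: "'d set" assume "A \<in> sets borel" "B \<in> sets borel"
    then show "\<exists>C. g -` A \<inter> space M \<inter> (g -` B \<inter> space M) = g -` C \<inter> space M \<and> C \<in> sets borel"
      by (intro exI[of _ "A \<inter> B"]) auto
  qed
  then show "Int_stable {Z n -` A \<inter> space M |A. A \<in> sets borel}" .
qed fact

text \<open>The law of \<open>g (Z n)\<close> is the image under \<open>g\<close> of the law of
  \<open>Z n\<close>. Together with the next lemma this serves twice: to pass from the pairs to one
  of their two vectors, and from a vector to its coordinates.\<close>

lemma ident_distr_compose:
  fixes Z :: "nat \<Rightarrow> 'a \<Rightarrow> 'b::topological_space" and g :: "'b \<Rightarrow> 'c::topological_space"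
  assumes Z: "\<And>n. n \<ge> 1 \<Longrightarrow> Z n \<in> borel_measurable M"
    and ident: "\<forall>n\<ge>1. distr M borel (Z n) = distr M borel (Z 1)" and g: "g \<in> borel_measurable borel"
  shows "\<forall>n\<ge>1. distr M borel (\<lambda>\<omega>. g (Z n \<omega>)) = distr M borel (\<lambda>\<omega>. g (Z 1 \<omega>))"
proof (intro allI impI)
  fix n :: nat assume n: "n \<ge> 1"
  have distr: "distr M borel (\<lambda>\<omega>. g (Z m \<omega>)) = distr (distr M borel (Z m)) borel g" if "m \<ge> 1" for m
    using distr_distr[OF g Z[OF that]] by (simp add: comp_def)
  have "distr M borel (Z n) = distr M borel (Z 1)"
    using ident n by blast
  then show "distr M borel (\<lambda>\<omega>. g (Z n \<omega>)) = distr M borel (\<lambda>\<omega>. g (Z 1 \<omega>))"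
    unfolding distr[OF n] distr[OF order_refl] by (rule arg_cong)
qed

lemma (in prob_space) indep_of_past_compose:
  assumes "indep_of_past F Z" and g: "g \<in> borel_measurable borel"
  shows "indep_of_past F (\<lambda>n \<omega>. g (Z n \<omega>))"
  unfolding indep_of_past_def
proof safe
  fix n :: nat assume "n \<ge> 1"
  then have indep: "indep_set {Z n -` A \<inter> space M |A. A \<in> sets borel} (sets (F (n - 1)))"
    using \<open>indep_of_past F Z\<close> unfolding indep_of_past_def by blast
  have "{(\<lambda>\<omega>. g (Z n \<omega>)) -` A \<inter> space M |A. A \<in> sets borel} \<subseteq> {Z n -` A \<inter> space M |A. A \<in> sets borel}"
  proof safe
    fix A :: "'c set" assume "A \<in> sets borel"
    with g have "g -` A \<in> sets borel"
      using measurable_sets[of g borel borel A] by simp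
    then show "\<exists>B. (\<lambda>\<omega>. g (Z n \<omega>)) -` A \<inter> space M = Z n -` B \<inter> space M \<and> B \<in> sets borel"
      by (intro exI[of _ "g -` A"]) auto
  qed
  then show "indep_set {(\<lambda>\<omega>. g (Z n \<omega>)) -` A \<inter> space M |A. A \<in> sets borel} (sets (F (n - 1)))"
    using indep unfolding indep_set_def
    by (elim indep_sets_mono_sets) (auto split: bool.split)
qed

text \<open>
  The terms \<open>\<beta>\<^sub>k (V\<^sub>k - E V\<^sub>1)\<close> are martingale differences, hence pairwise orthogonal, and independence
  factorises their second moments.
\<close>

lemma (in prob_space) predictable_SLLN:
  fixes \<beta> V :: "nat \<Rightarrow> 'a \<Rightarrow> real"
  assumes F: "filtration_of M F" and \<beta>: "predictable F \<beta>" and V: "adapted F V"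
    and indep: "indep_of_past F V"
    and ident: "\<forall>n\<ge>1. distr M borel (V n) = distr M borel (V 1)"
    and V_sq: "integrable M (\<lambda>\<omega>. (V 1 \<omega>)\<^sup>2)"
    and \<beta>_sq: "\<And>n. n \<ge> 1 \<Longrightarrow> integrable M (\<lambda>\<omega>. (\<beta> n \<omega>)\<^sup>2)"
    and \<beta>_le: "\<And>n. n \<ge> 1 \<Longrightarrow> expectation (\<lambda>\<omega>. (\<beta> n \<omega>)\<^sup>2) \<le> C"
  shows "AE \<omega> in M. (\<lambda>n. (\<Sum>k=1..n. \<beta> k \<omega> * (V k \<omega> - expectation (V 1))) / real n) \<longlonglongrightarrow> 0"
proof -
  define \<mu> where "\<mu> = expectation (V 1)"
  \<comment> \<open>The index is shifted by one: \<open>b k\<close> and \<open>W k\<close> belong to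
    coup k + 1, so that \<open>b k\<close> is known at time \<open>k\<close> while
    \<open>W k\<close> is independent of \<open>F k\<close>.\<close>
  define W where "W k \<omega> = V (Suc k) \<omega> - \<mu>" for k \<omega>
  define b where "b k = \<beta> (Suc k)" for k
  define D where "D k \<omega> = b k \<omega> * W k \<omega>" for k \<omega>
  have sub: "subalgebra M (F n)" for n
    using F by (simp add: filtration_of_def)
  have V_meas: "V n \<in> borel_measurable M" if "n \<ge> 1" for n
    using V that measurable_from_subalg[OF sub] by (auto simp: adapted_def)
  have b_F: "b k \<in> borel_measurable (F k)" for k
    using \<beta> by (auto simp: predictable_def b_def dest: spec[of _ "Suc k"])
  have V_F: "V (Suc k) \<in> borel_measurable (F (Suc k))" for k
    using V by (auto simp: adapted_def)
  have F_mono: "f \<in> borel_measurable (F j)" if "f \<in> borel_measurable (F i)" "i \<le> j"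
    for f :: "'a \<Rightarrow> real" and i j
  proof (rule measurable_from_subalg[OF _ that(1)])
    interpret filtration "space M" F
      using F by (simp add: filtration_of_def)
    show "subalgebra (F j) (F i)"
      using sets_F_mono[OF that(2)] by (simp add: subalgebra_def space_F)
  qed
  have W_F: "W k \<in> borel_measurable (F (Suc k))" for k
    unfolding W_def using V_F by measurable
  have D_F: "D k \<in> borel_measurable (F (Suc k))" for k
    unfolding D_def by (intro borel_measurable_times W_F F_mono[OF b_F]) simp
  have [measurable]: "b k \<in> borel_measurable M" "W k \<in> borel_measurable M" "D k \<in> borel_measurable M" for k
    by (rule measurable_from_subalg[OF sub b_F] measurable_from_subalg[OF sub W_F]
        measurable_from_subalg[OF sub D_F])+
  have b_sq: "integrable M (\<lambda>\<omega>. (b k \<omega>)\<^sup>2)" for k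
    using \<beta>_sq by (simp add: b_def)
  have ident': "integrable M (\<lambda>\<omega>. g (V (Suc k) \<omega>)) \<longleftrightarrow> integrable M (\<lambda>\<omega>. g (V 1 \<omega>))"
    "expectation (\<lambda>\<omega>. g (V (Suc k) \<omega>)) = expectation (\<lambda>\<omega>. g (V 1 \<omega>))"
    if g: "g \<in> borel_measurable borel" for g :: "real \<Rightarrow> real" and k
  proof -
    have V': "V (Suc k) \<in> borel_measurable M" "V 1 \<in> borel_measurable M"
      by (rule V_meas, simp)+
    have d: "distr M borel (V (Suc k)) = distr M borel (V 1)"
      using ident by (metis One_nat_def le_add1 plus_1_eq_Suc)
    show "integrable M (\<lambda>\<omega>. g (V (Suc k) \<omega>)) \<longleftrightarrow> integrable M (\<lambda>\<omega>. g (V 1 \<omega>))"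
      unfolding integrable_distr_eq[OF V'(1) g, symmetric] integrable_distr_eq[OF V'(2) g, symmetric] d ..
    show "expectation (\<lambda>\<omega>. g (V (Suc k) \<omega>)) = expectation (\<lambda>\<omega>. g (V 1 \<omega>))"
      unfolding integral_distr[OF V'(1) g, symmetric] integral_distr[OF V'(2) g, symmetric] d ..
  qed
  have V_int: "integrable M (V 1)"
    by (rule square_integrable_imp_integrable[OF V_meas V_sq]) simp
  have W_sq1: "integrable M (\<lambda>\<omega>. (V 1 \<omega> - \<mu>)\<^sup>2)"
    using V_int V_sq by (simp add: power2_diff)
  have W_sq: "integrable M (\<lambda>\<omega>. (W k \<omega>)\<^sup>2)"
    "expectation (\<lambda>\<omega>. (W k \<omega>)\<^sup>2) = variance (V 1)" for k
  proof -
    have g: "(\<lambda>x. (x - \<mu>)\<^sup>2) \<in> borel_measurable borel"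
      by measurable
    show "integrable M (\<lambda>\<omega>. (W k \<omega>)\<^sup>2)"
      unfolding W_def by (rule iffD2[OF ident'(1)[OF g] W_sq1])
    have "expectation (\<lambda>\<omega>. (W k \<omega>)\<^sup>2) = expectation (\<lambda>\<omega>. (V 1 \<omega> - \<mu>)\<^sup>2)"
      unfolding W_def by (rule ident'(2)[OF g])
    then show "expectation (\<lambda>\<omega>. (W k \<omega>)\<^sup>2) = variance (V 1)"
      by (simp only: \<mu>_def)
  qed
  have W_int: "integrable M (W k)" "expectation (W k) = 0" for k
  proof -
    have g: "(\<lambda>x. x - \<mu>) \<in> borel_measurable borel"
      by measurable
    have int: "integrable M (\<lambda>\<omega>. V 1 \<omega> - \<mu>)"
      using V_int by simp
    then show "integrable M (W k)"
      unfolding W_def[abs_def] by (rule iffD2[OF ident'(1)[OF g]])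
    have "expectation (W k) = expectation (\<lambda>\<omega>. V 1 \<omega> - \<mu>)"
      unfolding W_def[abs_def] by (rule ident'(2)[OF g])
    also have "\<dots> = 0"
      using V_int prob_space by (simp add: \<mu>_def)
    finally show "expectation (W k) = 0" .
  qed
  have indep_W: "indep_var borel f borel (\<lambda>\<omega>. g (W k \<omega>))"
    if f: "f \<in> borel_measurable (F k)" and g: "g \<in> borel_measurable borel"
    for f :: "'a \<Rightarrow> real" and g :: "real \<Rightarrow> real" and k
  proof -
    have V: "indep_var borel f borel (V (Suc k))"
      using f by (intro indep_of_past_imp_indep_var[OF F indep] V_meas) auto
    have "(\<lambda>x. g (x - \<mu>)) \<in> borel_measurable borel"
      using g by measurable
    from indep_var_compose[OF V measurable_ident this] show ?thesis
      by (simp add: comp_def W_def)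
  qed
  have D_sq_eq: "(\<lambda>\<omega>. (D k \<omega>)\<^sup>2) = (\<lambda>\<omega>. (b k \<omega>)\<^sup>2 * (W k \<omega>)\<^sup>2)" for k
    by (simp add: D_def power_mult_distrib)
  \<comment> \<open>Neither factor is bounded, so independence of the squares is what makes their
    product integrable, besides giving its expectation.\<close>
  have indep_sq: "indep_var borel (\<lambda>\<omega>. (b k \<omega>)\<^sup>2) borel (\<lambda>\<omega>. (W k \<omega>)\<^sup>2)" for k
  proof (rule indep_W)
    show "(\<lambda>\<omega>. (b k \<omega>)\<^sup>2) \<in> borel_measurable (F k)"
      using b_F by (rule borel_measurable_power)
    show "(\<lambda>x::real. x\<^sup>2) \<in> borel_measurable borel"
      by measurable
  qed
  have D_sq: "integrable M (\<lambda>\<omega>. (D k \<omega>)\<^sup>2)" for k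
    unfolding D_sq_eq by (intro indep_var_integrable indep_sq b_sq W_sq)
  have "AE \<omega> in M. (\<lambda>n. (\<Sum>k<n. D k \<omega>) / real n) \<longlonglongrightarrow> 0"
  proof (rule orthogonal_SLLN)
    show "integrable M (\<lambda>\<omega>. (D k \<omega>)\<^sup>2)" for k
      by (fact D_sq)
    show "expectation (\<lambda>\<omega>. (D k \<omega>)\<^sup>2) \<le> C * variance (V 1)" for k
    proof -
      have "expectation (\<lambda>\<omega>. (D k \<omega>)\<^sup>2) = expectation (\<lambda>\<omega>. (b k \<omega>)\<^sup>2) * variance (V 1)"
        unfolding D_sq_eq indep_var_lebesgue_integral[OF indep_sq b_sq W_sq(1)] W_sq(2) ..
      also have "\<dots> \<le> C * variance (V 1)"
        using \<beta>_le by (intro mult_right_mono variance_positive) (auto simp: b_def)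
      finally show ?thesis .
    qed
    show "expectation (\<lambda>\<omega>. D j \<omega> * D k \<omega>) = 0" if "j < k" for j k
    proof -
      \<comment> \<open>\<open>D j\<close> is known at time j + 1, which is at most
        \<open>k\<close>. All of the product except the centred factor \<open>W k\<close> is
        therefore known at time \<open>k\<close>.\<close>
      have Db_F: "(\<lambda>\<omega>. D j \<omega> * b k \<omega>) \<in> borel_measurable (F k)"
        using that by (intro borel_measurable_times b_F F_mono[OF D_F]) simp
      have "expectation (\<lambda>\<omega>. D j \<omega> * D k \<omega>) = expectation (\<lambda>\<omega>. (D j \<omega> * b k \<omega>) * W k \<omega>)"
        by (simp add: D_def mult.assoc)
      also have "\<dots> = expectation (\<lambda>\<omega>. D j \<omega> * b k \<omega>) * expectation (W k)"
      proof (rule indep_var_lebesgue_integral)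
        show "indep_var borel (\<lambda>\<omega>. D j \<omega> * b k \<omega>) borel (W k)"
          using indep_W[OF Db_F, of "\<lambda>x. x"] by simp
        \<comment> \<open>Both factors are square integrable, so their product is integrable
          although they may be dependent.\<close>
        show "integrable M (\<lambda>\<omega>. D j \<omega> * b k \<omega>)"
          by (intro integrable_mult_of_squares D_sq b_sq) measurable
      qed (fact W_int)
      finally show ?thesis
        by (simp add: W_int)
    qed
  qed measurable
  then show ?thesis
  proof eventually_elim
    case (elim \<omega>)
    have "(\<Sum>k<n. D k \<omega>) = (\<Sum>k=1..n. \<beta> k \<omega> * (V k \<omega> - \<mu>))" for n
      unfolding D_def b_def W_def by (rule sum.reindex_bij_witness[of _ "\<lambda>k. k - 1" Suc]) auto
    with elim show ?case
      by (simp add: \<mu>_def)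
  qed
qed

subsection \<open>Ratios of weighted sums\<close>

lemma liminf_limsup_eq_of_diff_tendsto_0:
  fixes f g :: "nat \<Rightarrow> real"
  assumes "(\<lambda>n. f n - g n) \<longlonglongrightarrow> 0"
  shows "liminf (\<lambda>n. ereal (f n)) = liminf (\<lambda>n. ereal (g n))"
    and "limsup (\<lambda>n. ereal (f n)) = limsup (\<lambda>n. ereal (g n))"
proof -
  have "(\<lambda>n. ereal (f n - g n)) \<longlonglongrightarrow> 0"
    using assms by (simp add: zero_ereal_def)
  from ereal_liminf_lim_add[OF this, of "\<lambda>n. ereal (g n)"] ereal_limsup_lim_add[OF this, of "\<lambda>n. ereal (g n)"]
  show "liminf (\<lambda>n. ereal (f n)) = liminf (\<lambda>n. ereal (g n))"
    "limsup (\<lambda>n. ereal (f n)) = limsup (\<lambda>n. ereal (g n))"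
    by simp_all
qed

text \<open>The quotient is the average of the numbers \<open>v $ i / b $ i\<close> with the weights
  \<open>t $ i * b $ i / (t \<bullet> b)\<close>, which are nonnegative and add up to 1.\<close>

lemma weighted_ratio_bounds:
  fixes t b v :: "real ^ 'd"
  assumes t: "\<And>i. 0 \<le> t $ i" and b: "\<And>i. 0 < b $ i" and pos: "0 < t \<bullet> b"
  shows "(\<And>i. a \<le> v $ i / b $ i) \<Longrightarrow> a \<le> (t \<bullet> v) / (t \<bullet> b)"
    and "(\<And>i. v $ i / b $ i \<le> a) \<Longrightarrow> (t \<bullet> v) / (t \<bullet> b) \<le> a"
proof -
  assume a: "a \<le> v $ i / b $ i" for i
  have "a * (t $ i * b $ i) \<le> t $ i * v $ i" for i
    using a[of i] t[of i] b[of i] mult_left_mono[of "a * b $ i" "v $ i" "t $ i"] by (simp add: pos_le_divide_eq mult_ac)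
  then have "a * (t \<bullet> b) \<le> t \<bullet> v"
    by (simp add: inner_vec_def sum_distrib_left sum_mono)
  with pos show "a \<le> (t \<bullet> v) / (t \<bullet> b)"
    by (simp add: pos_le_divide_eq)
next
  assume a: "v $ i / b $ i \<le> a" for i
  have "t $ i * v $ i \<le> a * (t $ i * b $ i)" for i
    using a[of i] t[of i] b[of i] mult_left_mono[of "v $ i" "a * b $ i" "t $ i"] by (simp add: pos_divide_le_eq mult_ac)
  then have "t \<bullet> v \<le> a * (t \<bullet> b)"
    by (simp add: inner_vec_def sum_distrib_left sum_mono)
  with pos show "(t \<bullet> v) / (t \<bullet> b) \<le> a"
    by (simp add: pos_divide_le_eq)
qed

text \<open>With m the quotient of \<open>T n \<bullet> v\<close> and
  \<open>T n \<bullet> b\<close>, the error q/p - m equals (q - Tv)/n - m (p - Tb)/n, divided by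
  p/n. Both differences are null sequences, m is bounded as a weighted average, and p/n is
  eventually bounded below; no upper bound on \<open>T n\<close> enters.\<close>

lemma ratio_asymptotics:
  fixes T :: "nat \<Rightarrow> real ^ 'd" and p q :: "nat \<Rightarrow> real"
  assumes T: "\<And>n i. 0 \<le> T n $ i" and b: "\<And>i. 0 < b $ i"
    and p: "(\<lambda>n. (p n - T n \<bullet> b) / real n) \<longlonglongrightarrow> 0"
    and q: "(\<lambda>n. (q n - T n \<bullet> v) / real n) \<longlonglongrightarrow> 0"
    and liminf: "0 < liminf (\<lambda>n. ereal (p n / real n))"
  shows "eventually (\<lambda>n. 0 < T n \<bullet> b) sequentially"
    and "(\<lambda>n. q n / p n - (T n \<bullet> v) / (T n \<bullet> b)) \<longlonglongrightarrow> 0"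
proof -
  obtain c where c: "0 < c" "eventually (\<lambda>n. c < p n / real n) sequentially"
  proof -
    obtain c where c: "0 < ereal c" "ereal c < liminf (\<lambda>n. ereal (p n / real n))"
      using ereal_dense2[OF liminf] by (auto simp: zero_ereal_def)
    from less_LiminfD[OF c(2)] c(1) show thesis
      by (intro that[of c]) auto
  qed
  \<comment> \<open>Half of the gap \<open>c\<close> is spent on the error, so the averages of
    \<open>T n \<bullet> b\<close> eventually stay above the other half; this makes the quotient of
    means meaningful.\<close>
  have "eventually (\<lambda>n. dist ((p n - T n \<bullet> b) / real n) 0 < c / 2) sequentially"
    using c(1) by (intro tendstoD[OF p]) simp
  with c(2) have pT: "eventually (\<lambda>n. 0 < n \<and> c < p n / real n \<and> c / 2 < (T n \<bullet> b) / real n) sequentially"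
    using eventually_gt_at_top[of 0]
  proof eventually_elim
    case (elim n)
    then have "\<bar>p n / real n - (T n \<bullet> b) / real n\<bar> < c / 2"
      by (simp add: diff_divide_distrib dist_real_def)
    then have "c / 2 < (T n \<bullet> b) / real n"
      using elim(1) by linarith
    with elim show ?case by simp
  qed
  then show pos: "eventually (\<lambda>n. 0 < T n \<bullet> b) sequentially"
  proof eventually_elim
    case (elim n)
    with c(1) have "0 < (T n \<bullet> b) / real n" by linarith
    with elim show ?case by (simp add: zero_less_divide_iff)
  qed
  define K where "K = Max (range (\<lambda>i. \<bar>v $ i / b $ i\<bar>))"
  have K: "\<bar>v $ i / b $ i\<bar> \<le> K" for i
    unfolding K_def by (rule Max_ge) auto
  define e where "e n = (\<bar>(q n - T n \<bullet> v) / real n\<bar> + K * \<bar>(p n - T n \<bullet> b) / real n\<bar>) / c" for n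
  have "e \<longlonglongrightarrow> (\<bar>0\<bar> + K * \<bar>0\<bar>) / c"
    unfolding e_def using c(1) by (intro tendsto_intros p q) simp
  then have e: "e \<longlonglongrightarrow> 0" by simp
  show "(\<lambda>n. q n / p n - (T n \<bullet> v) / (T n \<bullet> b)) \<longlonglongrightarrow> 0"
  proof (rule Lim_null_comparison[OF _ e])
    show "eventually (\<lambda>n. norm (q n / p n - (T n \<bullet> v) / (T n \<bullet> b)) \<le> e n) sequentially"
      using pT pos
    proof eventually_elim
      case (elim n)
      define m where "m = (T n \<bullet> v) / (T n \<bullet> b)"
      have m: "\<bar>m\<bar> \<le> K"
      proof -
        have K': "- K \<le> v $ i / b $ i" "v $ i / b $ i \<le> K" for i
          using K[of i] by linarith+
        have "- K \<le> m" "m \<le> K"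
          unfolding m_def using weighted_ratio_bounds[OF T b elim(2)] K' by blast+
        then show ?thesis by linarith
      qed
      define P where "P = p n / real n"
      have P: "c < P" "0 < P" "p n = P * real n"
        using elim c(1) by (auto simp: P_def)
      have Tv: "T n \<bullet> v = m * (T n \<bullet> b)"
        using elim by (simp add: m_def)
      \<comment> \<open>\<open>T n \<bullet> v\<close> may be replaced by
        \<open>m * (T n \<bullet> b)\<close>, and then these terms cancel on the right.\<close>
      have "q n / p n - m = ((q n - T n \<bullet> v) / real n - m * ((p n - T n \<bullet> b) / real n)) / P"
        using elim P(2) unfolding P(3) Tv by (simp add: field_simps)
      also have "\<bar>\<dots>\<bar> \<le> (\<bar>(q n - T n \<bullet> v) / real n\<bar> + K * \<bar>(p n - T n \<bullet> b) / real n\<bar>) / P"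
      proof -
        have triangle: "\<bar>x - m * y\<bar> \<le> \<bar>x\<bar> + K * \<bar>y\<bar>" for x y
          using abs_triangle_ineq4[of x "m * y"] mult_right_mono[OF m, of "\<bar>y\<bar>"] by (simp add: abs_mult)
        show ?thesis
          unfolding abs_divide[of _ P] abs_of_pos[OF P(2)] using P(2)
          by (intro divide_right_mono triangle) simp
      qed
      also have "\<dots> \<le> e n"
        unfolding e_def using P c(1) m by (intro divide_left_mono add_nonneg_nonneg mult_nonneg_nonneg) auto
      finally show ?case by (simp add: m_def)
    qed
  qed
qed

text \<open>The quotient is unchanged when \<open>T n\<close> is divided by the sum of its entries,
  so it is a function of the proportions. Their limit \<open>w\<close> is again a probability
  vector, which gives a positive denominator and hence continuity at \<open>w\<close>.\<close>

lemma weighted_ratio_tendsto: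
  fixes T :: "nat \<Rightarrow> real ^ 'd"
  assumes T: "\<And>n i. 0 \<le> T n $ i" and b: "\<And>i. 0 < b $ i"
    and pos: "eventually (\<lambda>n. 0 < T n \<bullet> b) sequentially"
    and w: "(\<lambda>n. T n /\<^sub>R (T n \<bullet> (\<chi> i. 1))) \<longlonglongrightarrow> w"
  shows "(\<lambda>n. (T n \<bullet> v) / (T n \<bullet> b)) \<longlonglongrightarrow> (w \<bullet> v) / (w \<bullet> b)"
proof -
  define s where "s n = T n \<bullet> (\<chi> i. 1)" for n
  define u where "u n = T n /\<^sub>R s n" for n
  have s_eq: "s n = (\<Sum>i\<in>UNIV. T n $ i)" for n
    by (simp add: s_def inner_vec_def)
  have u: "u \<longlonglongrightarrow> w"
    using w by (simp add: u_def[abs_def] s_def)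
  have s_pos: "eventually (\<lambda>n. 0 < s n) sequentially"
    using pos
  proof eventually_elim
    case (elim n)
    have "s n \<noteq> 0"
    proof
      assume "s n = 0"
      then have "T n $ i = 0" for i
        using T by (simp add: s_eq sum_nonneg_eq_0_iff)
      with elim show False
        by (simp add: inner_vec_def)
    qed
    moreover have "0 \<le> s n"
      unfolding s_eq by (intro sum_nonneg T)
    ultimately show ?case by simp
  qed
  \<comment> \<open>The proportions eventually add up to 1, hence so do the entries of
    \<open>w\<close>; in particular \<open>w\<close> is not the zero vector.\<close>
  have "(\<lambda>n. u n \<bullet> (\<chi> i. 1)) \<longlonglongrightarrow> w \<bullet> (\<chi> i. 1)"
    by (intro tendsto_intros u)
  moreover have "eventually (\<lambda>n. u n \<bullet> (\<chi> i. 1) = 1) sequentially"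
    using s_pos by eventually_elim (simp add: u_def s_def)
  ultimately have "w \<bullet> (\<chi> i. 1) = 1"
    by (metis LIMSEQ_unique tendsto_eventually)
  then obtain i where i: "w $ i \<noteq> 0"
    by (force simp: inner_vec_def)
  have w_nonneg: "0 \<le> w $ j" for j
  proof (rule tendsto_lowerbound)
    show "(\<lambda>n. u n $ j) \<longlonglongrightarrow> w $ j"
      by (intro tendsto_intros u)
    show "eventually (\<lambda>n. 0 \<le> u n $ j) sequentially"
      using s_pos by eventually_elim (simp add: u_def T)
  qed simp
  have "0 < w $ i"
    using w_nonneg[of i] i by simp
  then have "0 < (\<Sum>j\<in>UNIV. w $ j * b $ j)"
    by (intro sum_pos2[of _ i]) (auto intro!: mult_pos_pos mult_nonneg_nonneg w_nonneg b less_imp_le[OF b])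
  then have "(\<lambda>n. (u n \<bullet> v) / (u n \<bullet> b)) \<longlonglongrightarrow> (w \<bullet> v) / (w \<bullet> b)"
    by (intro tendsto_intros u) (simp add: inner_vec_def)
  moreover have "eventually (\<lambda>n. (u n \<bullet> v) / (u n \<bullet> b) = (T n \<bullet> v) / (T n \<bullet> b)) sequentially"
    using s_pos by eventually_elim (simp add: u_def)
  ultimately show ?thesis
    by (rule Lim_transform_eventually)
qed

subsection \<open>Second moments of random vectors\<close>

lemma second_moment_finite_iff:
  assumes [measurable]: "V \<in> borel_measurable M"
  shows "second_moment M V < \<infinity> \<longleftrightarrow> integrable M (\<lambda>\<omega>. (norm (V \<omega>))\<^sup>2)"
  unfolding second_moment_def integrable_iff_bounded by simp

lemma component_square_le: "(x $ i)\<^sup>2 \<le> (norm x)\<^sup>2" for x :: "real ^ 'd"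
  using component_le_norm_cart[of x i] by (simp add: abs_le_square_iff[symmetric])

lemma second_moment_component:
  assumes V[measurable]: "V \<in> borel_measurable M" and "second_moment M V < \<infinity>"
  shows "integrable M (\<lambda>\<omega>. (V \<omega> $ i)\<^sup>2)"
    and "(\<integral>\<omega>. (V \<omega> $ i)\<^sup>2 \<partial>M) \<le> enn2real (second_moment M V)"
proof -
  have int: "integrable M (\<lambda>\<omega>. (norm (V \<omega>))\<^sup>2)"
    using second_moment_finite_iff[OF V] assms(2) by blast
  have V_i [measurable]: "(\<lambda>\<omega>. V \<omega> $ i) \<in> borel_measurable M"
    using measurable_compose[OF V borel_measurable_nth] .
  show int_i: "integrable M (\<lambda>\<omega>. (V \<omega> $ i)\<^sup>2)"
    by (rule Bochner_Integration.integrable_bound[OF int]) (auto simp: component_square_le)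
  have "(\<integral>\<omega>. (V \<omega> $ i)\<^sup>2 \<partial>M) \<le> (\<integral>\<omega>. (norm (V \<omega>))\<^sup>2 \<partial>M)"
    by (rule integral_mono[OF int_i int component_square_le])
  also have "\<dots> = enn2real (second_moment M V)"
    unfolding second_moment_def by (rule integral_eq_nn_integral) auto
  finally show "(\<integral>\<omega>. (V \<omega> $ i)\<^sup>2 \<partial>M) \<le> enn2real (second_moment M V)" .
qed

text \<open>It yields both directions of the equivalence of the moment conditions, from X = R + (-B)
  and R = X + B. The equation is required on \<open>space M\<close> only, as the profit is specified
  only there.\<close>

lemma second_moment_add_finite:
  assumes [measurable]: "V \<in> borel_measurable M" "W \<in> borel_measurable M"
    and fin: "second_moment M V < \<infinity>" "second_moment M W < \<infinity>"
    and eq: "\<And>\<omega>. \<omega> \<in> space M \<Longrightarrow> U \<omega> = V \<omega> + W \<omega>"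
  shows "second_moment M U < \<infinity>"
proof -
  have le: "(norm (x + y))\<^sup>2 \<le> 2 * (norm x)\<^sup>2 + 2 * (norm y)\<^sup>2" for x y :: "real ^ 'd"
  proof -
    have "(norm (x + y))\<^sup>2 \<le> (norm x + norm y)\<^sup>2"
      by (intro power_mono norm_triangle_ineq) simp
    also have "\<dots> \<le> 2 * (norm x)\<^sup>2 + 2 * (norm y)\<^sup>2"
      using sum_squares_bound[of "norm x" "norm y"] by (simp add: power2_sum)
    finally show ?thesis .
  qed
  have "integrable M (\<lambda>\<omega>. 2 * (norm (V \<omega>))\<^sup>2 + 2 * (norm (W \<omega>))\<^sup>2)"
    using fin[unfolded second_moment_finite_iff[OF assms(1)] second_moment_finite_iff[OF assms(2)]]
    by simp
  then have "integrable M (\<lambda>\<omega>. (norm (V \<omega> + W \<omega>))\<^sup>2)"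
    by (rule Bochner_Integration.integrable_bound) (auto simp: le)
  then have "second_moment M (\<lambda>\<omega>. V \<omega> + W \<omega>) < \<infinity>"
    by (subst second_moment_finite_iff) measurable
  also have "second_moment M (\<lambda>\<omega>. V \<omega> + W \<omega>) = second_moment M U"
    unfolding second_moment_def by (intro nn_integral_cong) (simp add: eq)
  finally show ?thesis .
qed

text \<open>The dot product is a sum over finitely many coordinates, and the scalar law applies to
  each of them, whatever the dependence among the entries of one coup.\<close>

lemma (in prob_space) predictable_SLLN_vec:
  fixes \<beta> V :: "nat \<Rightarrow> 'a \<Rightarrow> real ^ 'd"
  assumes F: "filtration_of M F" and \<beta>: "predictable F \<beta>" and V: "adapted F V"
    and indep: "indep_of_past F V"
    and ident: "\<forall>n\<ge>1. distr M borel (V n) = distr M borel (V 1)"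
    and V_sq: "second_moment M (V 1) < \<infinity>"
    and \<beta>_sq: "(SUP n\<in>{1..}. second_moment M (\<beta> n)) < \<infinity>"
  shows "AE \<omega> in M. (\<lambda>n. ((\<Sum>k=1..n. \<beta> k \<omega> \<bullet> V k \<omega>) - (\<Sum>k=1..n. \<beta> k \<omega>) \<bullet> mean_vec M (V 1)) / real n) \<longlonglongrightarrow> 0"
proof -
  have nth [measurable]: "(\<lambda>x::real ^ 'd. x $ i) \<in> borel_measurable borel" for i
    by (rule borel_measurable_nth)
  have sub: "subalgebra M (F n)" for n
    using F by (simp add: filtration_of_def)
  have V_F: "V n \<in> borel_measurable (F n)" and \<beta>_F: "\<beta> n \<in> borel_measurable (F (n - 1))" if "n \<ge> 1" for n
    using V \<beta> that by (simp_all add: adapted_def predictable_def)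
  have V_M: "V n \<in> borel_measurable M" and \<beta>_M: "\<beta> n \<in> borel_measurable M" if "n \<ge> 1" for n
    using measurable_from_subalg[OF sub] V_F[OF that] \<beta>_F[OF that] by blast+
  have le_SUP: "second_moment M (\<beta> n) \<le> (SUP n\<in>{1..}. second_moment M (\<beta> n))" if "n \<ge> 1" for n
    using that by (intro SUP_upper) simp
  have "AE \<omega> in M. (\<lambda>n. (\<Sum>k=1..n. \<beta> k \<omega> $ i * (V k \<omega> $ i - expectation (\<lambda>\<omega>. V 1 \<omega> $ i))) / real n) \<longlonglongrightarrow> 0" for i
  proof (rule predictable_SLLN[OF F])
    show "predictable F (\<lambda>k \<omega>. \<beta> k \<omega> $ i)"
      unfolding predictable_def using measurable_compose[OF \<beta>_F nth] by blast
    show "adapted F (\<lambda>k \<omega>. V k \<omega> $ i)"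
      unfolding adapted_def using measurable_compose[OF V_F nth] by blast
    show "indep_of_past F (\<lambda>k \<omega>. V k \<omega> $ i)"
      by (rule indep_of_past_compose[OF indep nth])
    show "\<forall>n\<ge>1. distr M borel (\<lambda>\<omega>. V n \<omega> $ i) = distr M borel (\<lambda>\<omega>. V 1 \<omega> $ i)"
      by (rule ident_distr_compose[OF V_M ident nth])
    show "integrable M (\<lambda>\<omega>. (V 1 \<omega> $ i)\<^sup>2)"
      using V_M V_sq by (intro second_moment_component) auto
    show "integrable M (\<lambda>\<omega>. (\<beta> n \<omega> $ i)\<^sup>2)"
      "expectation (\<lambda>\<omega>. (\<beta> n \<omega> $ i)\<^sup>2) \<le> enn2real (SUP n\<in>{1..}. second_moment M (\<beta> n))" if n: "n \<ge> 1" for n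
    proof -
      have fin: "second_moment M (\<beta> n) < \<infinity>"
        using le_SUP[OF n] \<beta>_sq by (rule order.strict_trans1)
      then show "integrable M (\<lambda>\<omega>. (\<beta> n \<omega> $ i)\<^sup>2)"
        by (rule second_moment_component(1)[OF \<beta>_M[OF n]])
      \<comment> \<open>The constant of the scalar law is the supremum read as a real number; its
        finiteness makes this conversion monotone here.\<close>
      have "enn2real (second_moment M (\<beta> n)) \<le> enn2real (SUP n\<in>{1..}. second_moment M (\<beta> n))"
        using le_SUP[OF n] \<beta>_sq by (intro enn2real_mono) auto
      with second_moment_component(2)[OF \<beta>_M[OF n] fin, of i]
      show "expectation (\<lambda>\<omega>. (\<beta> n \<omega> $ i)\<^sup>2) \<le> enn2real (SUP n\<in>{1..}. second_moment M (\<beta> n))"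
        by (rule order_trans)
    qed
  qed
  then have "AE \<omega> in M. \<forall>i. (\<lambda>n. (\<Sum>k=1..n. \<beta> k \<omega> $ i * (V k \<omega> $ i - expectation (\<lambda>\<omega>. V 1 \<omega> $ i))) / real n) \<longlonglongrightarrow> 0"
    by (simp add: AE_all_countable)
  then show ?thesis
  proof eventually_elim
    case (elim \<omega>)
    have "((\<Sum>k=1..n. \<beta> k \<omega> \<bullet> V k \<omega>) - (\<Sum>k=1..n. \<beta> k \<omega>) \<bullet> mean_vec M (V 1)) / real n =
        (\<Sum>i\<in>UNIV. (\<Sum>k=1..n. \<beta> k \<omega> $ i * (V k \<omega> $ i - expectation (\<lambda>\<omega>. V 1 \<omega> $ i))) / real n)" for n
    proof -
      have "(\<Sum>k=1..n. \<beta> k \<omega> \<bullet> V k \<omega>) - (\<Sum>k=1..n. \<beta> k \<omega>) \<bullet> mean_vec M (V 1) =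
          (\<Sum>k=1..n. \<Sum>i\<in>UNIV. \<beta> k \<omega> $ i * (V k \<omega> $ i - expectation (\<lambda>\<omega>. V 1 \<omega> $ i)))"
        unfolding inner_sum_left
        by (simp add: inner_vec_def mean_vec_def sum_subtractf right_diff_distrib)
      also have "\<dots> = (\<Sum>i\<in>UNIV. \<Sum>k=1..n. \<beta> k \<omega> $ i * (V k \<omega> $ i - expectation (\<lambda>\<omega>. V 1 \<omega> $ i)))"
        by (rule sum.swap)
      finally show ?thesis
        by (simp only: sum_divide_distrib)
    qed
    moreover have "(\<lambda>n. \<Sum>i\<in>UNIV. (\<Sum>k=1..n. \<beta> k \<omega> $ i * (V k \<omega> $ i - expectation (\<lambda>\<omega>. V 1 \<omega> $ i))) / real n) \<longlonglongrightarrow> (\<Sum>i\<in>(UNIV :: 'd set). 0)"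
      by (intro tendsto_sum) (use elim in blast)
    ultimately show ?case
      by simp
  qed
qed

subsection \<open>Cumulative ratios\<close>

text \<open>\<open>V\<close> stands for the returns or the profits. The bounds \<open>a\<close> and
  \<open>c\<close> are left free: the extreme ratios give the general chain, and a common value of
  all ratios taken for both gives convergence.\<close>

lemma (in prob_space) cum_ratio_asymptotics:
  fixes \<beta> B V :: "nat \<Rightarrow> 'a \<Rightarrow> real ^ 'd"
  assumes F: "filtration_of M F" and \<beta>: "predictable F \<beta>"
    and B: "adapted F B" "indep_of_past F B" "\<forall>n\<ge>1. distr M borel (B n) = distr M borel (B 1)"
      "second_moment M (B 1) < \<infinity>"
    and V: "adapted F V" "indep_of_past F V" "\<forall>n\<ge>1. distr M borel (V n) = distr M borel (V 1)"
      "second_moment M (V 1) < \<infinity>"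
    and \<beta>_sq: "(SUP n\<in>{1..}. second_moment M (\<beta> n)) < \<infinity>"
    and \<beta>_nonneg: "\<forall>n\<ge>1. \<forall>\<omega>\<in>space M. \<forall>j. \<beta> n \<omega> $ j \<ge> 0"
    and b: "\<And>i. 0 < mean_vec M (B 1) $ i"
    and liminf: "AE \<omega> in M. liminf (\<lambda>n. ereal ((1 / real n) * (\<Sum>k=1..n. \<beta> k \<omega> \<bullet> B k \<omega>))) > 0"
  defines "ratio \<equiv> cum_ratio (\<lambda>k \<omega>. \<beta> k \<omega> \<bullet> V k \<omega>) (\<lambda>k \<omega>. \<beta> k \<omega> \<bullet> B k \<omega>)"
    and "mratio \<equiv> cum_ratio (\<lambda>k \<omega>. \<beta> k \<omega> \<bullet> mean_vec M (V 1)) (\<lambda>k \<omega>. \<beta> k \<omega> \<bullet> mean_vec M (B 1))"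
  shows cum_ratio_bounds: "\<And>a c. (\<And>i. a \<le> mean_vec M (V 1) $ i / mean_vec M (B 1) $ i) \<Longrightarrow>
      (\<And>i. mean_vec M (V 1) $ i / mean_vec M (B 1) $ i \<le> c) \<Longrightarrow>
      AE \<omega> in M.
        ereal a \<le> liminf (\<lambda>n. ereal (mratio n \<omega>)) \<and>
        liminf (\<lambda>n. ereal (mratio n \<omega>)) = liminf (\<lambda>n. ereal (ratio n \<omega>)) \<and>
        liminf (\<lambda>n. ereal (ratio n \<omega>)) \<le> limsup (\<lambda>n. ereal (ratio n \<omega>)) \<and>
        limsup (\<lambda>n. ereal (ratio n \<omega>)) = limsup (\<lambda>n. ereal (mratio n \<omega>)) \<and>
        limsup (\<lambda>n. ereal (mratio n \<omega>)) \<le> ereal c"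
    and cum_ratio_tendsto_of_proportions: "\<And>w.
      (AE \<omega> in M. (\<lambda>n. (\<Sum>k=1..n. \<beta> k \<omega>) /\<^sub>R (\<Sum>k=1..n. \<beta> k \<omega> \<bullet> (\<chi> i. 1))) \<longlonglongrightarrow> w) \<Longrightarrow>
      AE \<omega> in M. (\<lambda>n. ratio n \<omega>) \<longlonglongrightarrow> (w \<bullet> mean_vec M (V 1)) / (w \<bullet> mean_vec M (B 1))"
proof -
  define T where "T \<omega> n = (\<Sum>k=1..n. \<beta> k \<omega>)" for \<omega> n
  define b where "b = mean_vec M (B 1)"
  define v where "v = mean_vec M (V 1)"
  have b_pos: "0 < b $ i" for i
    using b by (simp add: b_def)
  \<comment> \<open>The means do not depend on the coup, so the quotient of means depends on the
    bets only through their cumulative vector.\<close>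
  have mratio: "mratio n \<omega> = (T \<omega> n \<bullet> v) / (T \<omega> n \<bullet> b)" for n \<omega>
    by (simp add: mratio_def cum_ratio_def T_def v_def b_def inner_sum_left)
  have T_nonneg: "0 \<le> T \<omega> n $ i" if "\<omega> \<in> space M" for \<omega> n i
    unfolding T_def sum_component using \<beta>_nonneg that by (intro sum_nonneg) auto
  have main: "AE \<omega> in M. (\<forall>n i. 0 \<le> T \<omega> n $ i) \<and> eventually (\<lambda>n. 0 < T \<omega> n \<bullet> b) sequentially \<and>
      (\<lambda>n. ratio n \<omega> - mratio n \<omega>) \<longlonglongrightarrow> 0"
    using predictable_SLLN_vec[OF F \<beta> B \<beta>_sq] predictable_SLLN_vec[OF F \<beta> V \<beta>_sq] liminf AE_space
  proof eventually_elim
    case (elim \<omega>)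
    define p where "p n = (\<Sum>k=1..n. \<beta> k \<omega> \<bullet> B k \<omega>)" for n
    define q where "q n = (\<Sum>k=1..n. \<beta> k \<omega> \<bullet> V k \<omega>)" for n
    have p: "(\<lambda>n. (p n - T \<omega> n \<bullet> b) / real n) \<longlonglongrightarrow> 0" and q: "(\<lambda>n. (q n - T \<omega> n \<bullet> v) / real n) \<longlonglongrightarrow> 0"
      using elim(1,2) by (simp_all only: p_def q_def T_def b_def v_def)
    have l: "0 < liminf (\<lambda>n. ereal (p n / real n))"
      using elim(3) by (simp add: p_def)
    have "ratio n \<omega> = q n / p n" for n
      by (simp add: ratio_def cum_ratio_def p_def q_def)
    with ratio_asymptotics[OF T_nonneg[OF elim(4)] b_pos p q l] T_nonneg[OF elim(4)] show ?case
      by (simp only: mratio) blast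
  qed
  show "AE \<omega> in M.
      ereal a \<le> liminf (\<lambda>n. ereal (mratio n \<omega>)) \<and>
      liminf (\<lambda>n. ereal (mratio n \<omega>)) = liminf (\<lambda>n. ereal (ratio n \<omega>)) \<and>
      liminf (\<lambda>n. ereal (ratio n \<omega>)) \<le> limsup (\<lambda>n. ereal (ratio n \<omega>)) \<and>
      limsup (\<lambda>n. ereal (ratio n \<omega>)) = limsup (\<lambda>n. ereal (mratio n \<omega>)) \<and>
      limsup (\<lambda>n. ereal (mratio n \<omega>)) \<le> ereal c"
    if a: "\<And>i. a \<le> mean_vec M (V 1) $ i / mean_vec M (B 1) $ i"
      and c: "\<And>i. mean_vec M (V 1) $ i / mean_vec M (B 1) $ i \<le> c" for a c
    using main
  proof eventually_elim
    case (elim \<omega>)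
    have T0: "0 \<le> T \<omega> n $ i" for n i
      using elim by blast
    have "eventually (\<lambda>n. a \<le> mratio n \<omega> \<and> mratio n \<omega> \<le> c) sequentially"
      using elim[THEN conjunct2, THEN conjunct1]
    proof eventually_elim
      case (elim n)
      show ?case
        unfolding mratio using weighted_ratio_bounds[OF T0 b_pos elim] a c unfolding b_def v_def by blast
    qed
    then have ev: "eventually (\<lambda>n. ereal a \<le> ereal (mratio n \<omega>)) sequentially"
      "eventually (\<lambda>n. ereal (mratio n \<omega>) \<le> ereal c) sequentially"
      by (auto elim: eventually_mono)
    show ?case
      using liminf_limsup_eq_of_diff_tendsto_0[OF elim[THEN conjunct2, THEN conjunct2]]
        Liminf_bounded[OF ev(1)] Limsup_bounded[OF ev(2)]
      by (auto intro: Liminf_le_Limsup)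
  qed
  show "AE \<omega> in M. (\<lambda>n. ratio n \<omega>) \<longlonglongrightarrow> (w \<bullet> mean_vec M (V 1)) / (w \<bullet> mean_vec M (B 1))"
    if w: "AE \<omega> in M. (\<lambda>n. (\<Sum>k=1..n. \<beta> k \<omega>) /\<^sub>R (\<Sum>k=1..n. \<beta> k \<omega> \<bullet> (\<chi> i. 1))) \<longlonglongrightarrow> w" for w
    using main w
  proof eventually_elim
    case (elim \<omega>)
    have "(\<lambda>n. T \<omega> n /\<^sub>R (T \<omega> n \<bullet> (\<chi> i. 1))) \<longlonglongrightarrow> w"
      using elim(2) by (simp only: T_def inner_sum_left)
    with elim(1) have "(\<lambda>n. mratio n \<omega>) \<longlonglongrightarrow> (w \<bullet> v) / (w \<bullet> b)"
      unfolding mratio by (intro weighted_ratio_tendsto b_pos) auto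
    from tendsto_add[OF elim(1)[THEN conjunct2, THEN conjunct2] this] show ?case
      by (simp add: b_def v_def)
  qed
qed

text \<open>The type \<open>'d\<close> has no distinguished first element, so under equal ratios the
  limit is identified with the value at every \<open>i\<close>.\<close>

theorem corollary8p1:
  fixes M :: "'a measure"
    and F :: "nat \<Rightarrow> 'a measure"
    and Bbase :: "nat \<Rightarrow> 'a \<Rightarrow> real ^ 'd::finite"
    and B R X :: "nat \<Rightarrow> 'a \<Rightarrow> real ^ 'd"
  assumes "prob_space M"
    and "filtration_of M F"
    and "predictable F Bbase"
    and "\<And>n j \<omega>. n \<ge> 1 \<Longrightarrow> \<omega> \<in> space M \<Longrightarrow> Bbase n \<omega> $ j \<ge> 0"
    and "\<And>n j \<omega>. n \<ge> 1 \<Longrightarrow> \<omega> \<in> space M \<Longrightarrow> B n \<omega> $ j \<ge> 1"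
    and "\<And>n j \<omega>. n \<ge> 1 \<Longrightarrow> \<omega> \<in> space M \<Longrightarrow> R n \<omega> $ j \<ge> 0"
    and "\<And>n j \<omega>. n \<ge> 1 \<Longrightarrow> \<omega> \<in> space M \<Longrightarrow> X n \<omega> $ j = R n \<omega> $ j - B n \<omega> $ j"
    and "prob_space.iid M (\<lambda>n \<omega>. (B n \<omega>, R n \<omega>))"
    and "prob_space.iid M (\<lambda>n \<omega>. (B n \<omega>, X n \<omega>))"
    and "adapted F (\<lambda>n \<omega>. (B n \<omega>, R n \<omega>))"
    and "adapted F (\<lambda>n \<omega>. (B n \<omega>, X n \<omega>))"
    and "prob_space.indep_of_past M F (\<lambda>n \<omega>. (B n \<omega>, R n \<omega>))"
    and "prob_space.indep_of_past M F (\<lambda>n \<omega>. (B n \<omega>, X n \<omega>))"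
    and "(SUP n\<in>{1..}. second_moment M (Bbase n)) < \<infinity>"
    and "AE \<omega> in M. liminf (\<lambda>n. ereal ((1 / real n) * (\<Sum>k=1..n. Bbase k \<omega> \<bullet> B k \<omega>))) > 0"
    and "second_moment M (B 1) < \<infinity>"
  shows
    "let bet = (\<lambda>k \<omega>. Bbase k \<omega> \<bullet> B k \<omega>);
         meanbet = (\<lambda>k \<omega>. Bbase k \<omega> \<bullet> mean_vec M (B 1));
         RR = cum_ratio (\<lambda>k \<omega>. Bbase k \<omega> \<bullet> R k \<omega>) bet;
         XX = cum_ratio (\<lambda>k \<omega>. Bbase k \<omega> \<bullet> X k \<omega>) bet;
         mRR = cum_ratio (\<lambda>k \<omega>. Bbase k \<omega> \<bullet> mean_vec M (R 1)) meanbet;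
         mXX = cum_ratio (\<lambda>k \<omega>. Bbase k \<omega> \<bullet> mean_vec M (X 1)) meanbet;
         rtp = (\<lambda>i::'d. RTP M (\<lambda>\<omega>. B 1 \<omega> $ i) (\<lambda>\<omega>. R 1 \<omega> $ i));
         ha = (\<lambda>i::'d. HA M (\<lambda>\<omega>. B 1 \<omega> $ i) (\<lambda>\<omega>. X 1 \<omega> $ i));
         mb = (\<lambda>i::'d. \<integral>\<omega>. B 1 \<omega> $ i \<partial>M)
     in
      (second_moment M (R 1) < \<infinity> \<longleftrightarrow> second_moment M (X 1) < \<infinity>) \<and>
      (second_moment M (R 1) < \<infinity> \<longrightarrow>
        (AE \<omega> in M.
            ereal (MIN i. rtp i) \<le> liminf (\<lambda>n. ereal (mRR n \<omega>)) \<and>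
            liminf (\<lambda>n. ereal (mRR n \<omega>)) = liminf (\<lambda>n. ereal (RR n \<omega>)) \<and>
            liminf (\<lambda>n. ereal (RR n \<omega>)) \<le> limsup (\<lambda>n. ereal (RR n \<omega>)) \<and>
            limsup (\<lambda>n. ereal (RR n \<omega>)) = limsup (\<lambda>n. ereal (mRR n \<omega>)) \<and>
            limsup (\<lambda>n. ereal (mRR n \<omega>)) \<le> ereal (MAX i. rtp i)) \<and>
        (AE \<omega> in M.
            ereal (- (MAX i. ha i)) \<le> liminf (\<lambda>n. ereal (mXX n \<omega>)) \<and>
            liminf (\<lambda>n. ereal (mXX n \<omega>)) = liminf (\<lambda>n. ereal (XX n \<omega>)) \<and>
            liminf (\<lambda>n. ereal (XX n \<omega>)) \<le> limsup (\<lambda>n. ereal (XX n \<omega>)) \<and>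
            limsup (\<lambda>n. ereal (XX n \<omega>)) = limsup (\<lambda>n. ereal (mXX n \<omega>)) \<and>
            limsup (\<lambda>n. ereal (mXX n \<omega>)) \<le> ereal (- (MIN i. ha i))) \<and>
        ((\<forall>i j. rtp i = rtp j) \<longleftrightarrow> (\<forall>i j. ha i = ha j)) \<and>
        ((\<forall>i j. rtp i = rtp j) \<longrightarrow>
          (\<forall>i. (AE \<omega> in M. (\<lambda>n. RR n \<omega>) \<longlonglongrightarrow> rtp i) \<and>
               (AE \<omega> in M. (\<lambda>n. XX n \<omega>) \<longlonglongrightarrow> - ha i))) \<and>
        (\<forall>w :: real ^ 'd.
          (AE \<omega> in M. (\<lambda>n. (\<Sum>k=1..n. Bbase k \<omega>) /\<^sub>R (\<Sum>k=1..n. Bbase k \<omega> \<bullet> (\<chi> i. 1)))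
              \<longlonglongrightarrow> w) \<longrightarrow>
          (AE \<omega> in M. (\<lambda>n. RR n \<omega>)
              \<longlonglongrightarrow> (\<Sum>i\<in>UNIV. w $ i * mb i * rtp i) / (\<Sum>i\<in>UNIV. w $ i * mb i)) \<and>
          (AE \<omega> in M. (\<lambda>n. XX n \<omega>)
              \<longlonglongrightarrow> - ((\<Sum>i\<in>UNIV. w $ i * mb i * ha i) / (\<Sum>i\<in>UNIV. w $ i * mb i)))))"
proof -
  interpret prob_space M by fact
  note F = assms(2) and \<beta> = assms(3) and B_ge = assms(5) and X_eq = assms(7)
    and \<beta>_sq = assms(14) and liminf = assms(15) and B_sq = assms(16)
  have \<beta>_nonneg: "\<forall>n\<ge>1. \<forall>\<omega>\<in>space M. \<forall>j. Bbase n \<omega> $ j \<ge> 0"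
    using assms(4) by blast
  have sub: "subalgebra M (F n)" for n
    using F by (simp add: filtration_of_def)
  have fst: "(fst :: (real ^ 'd) \<times> (real ^ 'd) \<Rightarrow> _) \<in> borel_measurable borel"
    and snd: "(snd :: (real ^ 'd) \<times> (real ^ 'd) \<Rightarrow> _) \<in> borel_measurable borel"
    by (intro borel_measurable_continuous_onI continuous_intros)+
  have proj: "adapted F (\<lambda>n \<omega>. g (Z n \<omega>))" "indep_of_past F (\<lambda>n \<omega>. g (Z n \<omega>))"
    "\<forall>n\<ge>1. distr M borel (\<lambda>\<omega>. g (Z n \<omega>)) = distr M borel (\<lambda>\<omega>. g (Z 1 \<omega>))"
    if Z: "iid Z" "adapted F Z" "indep_of_past F Z" and g: "g \<in> borel_measurable borel"
    for Z :: "nat \<Rightarrow> 'a \<Rightarrow> (real ^ 'd) \<times> (real ^ 'd)" and g :: "_ \<Rightarrow> real ^ 'd"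
  proof -
    have Z_F: "Z n \<in> borel_measurable (F n)" if "n \<ge> 1" for n
      using Z(2) that by (simp add: adapted_def)
    then have Z_M: "Z n \<in> borel_measurable M" if "n \<ge> 1" for n
      using measurable_from_subalg[OF sub] that by blast
    show "adapted F (\<lambda>n \<omega>. g (Z n \<omega>))"
      unfolding adapted_def using measurable_compose[OF Z_F g] by blast
    show "indep_of_past F (\<lambda>n \<omega>. g (Z n \<omega>))"
      by (rule indep_of_past_compose[OF Z(3) g])
    show "\<forall>n\<ge>1. distr M borel (\<lambda>\<omega>. g (Z n \<omega>)) = distr M borel (\<lambda>\<omega>. g (Z 1 \<omega>))"
      by (rule ident_distr_compose[OF Z_M Z(1)[unfolded iid_def, THEN conjunct2] g])
  qed
  note B = proj[OF assms(8,10,12) fst, unfolded fst_conv] and R = proj[OF assms(8,10,12) snd, unfolded snd_conv]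
    and X = proj[OF assms(9,11,13) snd, unfolded snd_conv]
  have meas_1: "V 1 \<in> borel_measurable M" if "adapted F V" for V :: "nat \<Rightarrow> 'a \<Rightarrow> real ^ 'd"
    using that measurable_from_subalg[OF sub, of "V 1" 1] by (simp add: adapted_def)
  note meas = meas_1[OF B(1)] meas_1[OF R(1)] meas_1[OF X(1)]
  have XB: "X 1 \<omega> = R 1 \<omega> - B 1 \<omega>" if "\<omega> \<in> space M" for \<omega>
    using X_eq[OF _ that] by (simp add: vec_eq_iff)
  have R_iff_X: "second_moment M (R 1) < \<infinity> \<longleftrightarrow> second_moment M (X 1) < \<infinity>"
  proof
    assume R_sq: "second_moment M (R 1) < \<infinity>"
    have "(\<lambda>\<omega>. - B 1 \<omega>) \<in> borel_measurable M"
      using meas(1) by (rule borel_measurable_uminus)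
    moreover have "second_moment M (\<lambda>\<omega>. - B 1 \<omega>) < \<infinity>"
      using B_sq unfolding second_moment_def norm_minus_cancel .
    ultimately show "second_moment M (X 1) < \<infinity>"
      by (rule second_moment_add_finite[OF meas(2) _ R_sq]) (simp only: XB diff_conv_add_uminus)
  next
    assume "second_moment M (X 1) < \<infinity>"
    then show "second_moment M (R 1) < \<infinity>"
      by (rule second_moment_add_finite[OF meas(3,1) _ B_sq]) (simp add: XB[unfolded One_nat_def])
  qed
  define b where "b = mean_vec M (B 1)"
  define r where "r = mean_vec M (R 1)"
  define x where "x = mean_vec M (X 1)"
  define rtp where "rtp i = RTP M (\<lambda>\<omega>. B 1 \<omega> $ i) (\<lambda>\<omega>. R 1 \<omega> $ i)" for i
  define ha where "ha i = HA M (\<lambda>\<omega>. B 1 \<omega> $ i) (\<lambda>\<omega>. X 1 \<omega> $ i)" for i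
  have int: "integrable M (\<lambda>\<omega>. V \<omega> $ i)"
    if "V \<in> borel_measurable M" "second_moment M V < \<infinity>" for V :: "'a \<Rightarrow> real ^ 'd" and i
    by (rule square_integrable_imp_integrable[OF measurable_compose[OF that(1) borel_measurable_nth]
          second_moment_component(1)[OF that]])
  \<comment> \<open>A total bet contains the one-unit base bet, so its mean is at least 1.\<close>
  have b_pos: "0 < b $ i" for i
  proof -
    have "1 = expectation (\<lambda>_. 1 :: real)"
      by (simp add: prob_space)
    also have "\<dots> \<le> expectation (\<lambda>\<omega>. B 1 \<omega> $ i)"
      by (rule integral_mono[OF _ int[OF meas(1) B_sq]]) (simp_all add: B_ge)
    finally show ?thesis
      by (simp add: b_def mean_vec_def)
  qed
  \<comment> \<open>With the sign of \<open>ha\<close> reversed, both quantities are ratios of means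
    of the form treated above; negation will exchange maximum and minimum.\<close>
  have rtp: "rtp i = r $ i / b $ i" and ha: "- ha i = x $ i / b $ i" for i
    by (simp_all add: rtp_def ha_def RTP_def HA_def r_def b_def x_def mean_vec_def)
  \<comment> \<open>Multiplying a ratio by the mean bet restores the mean return or profit, which
    turns the limit for given proportions into the stated form.\<close>
  have weighted: "w \<bullet> r = (\<Sum>i\<in>UNIV. w $ i * b $ i * rtp i)" "w \<bullet> x = - (\<Sum>i\<in>UNIV. w $ i * b $ i * ha i)"
    "w \<bullet> b = (\<Sum>i\<in>UNIV. w $ i * b $ i)" for w
  proof -
    have b0: "b $ i \<noteq> 0" for i
      using b_pos[of i] by simp
    have "ha i = - (x $ i / b $ i)" for i
      using ha[of i] by simp
    then show "w \<bullet> r = (\<Sum>i\<in>UNIV. w $ i * b $ i * rtp i)" "w \<bullet> x = - (\<Sum>i\<in>UNIV. w $ i * b $ i * ha i)"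
      "w \<bullet> b = (\<Sum>i\<in>UNIV. w $ i * b $ i)"
      by (simp_all add: rtp inner_vec_def b0 sum_negf)
  qed
  have mb: "expectation (\<lambda>\<omega>. B 1 \<omega> $ i) = b $ i" for i
    by (simp add: b_def mean_vec_def)
  show ?thesis
  proof (cases "second_moment M (R 1) < \<infinity>")
    case False
    with R_iff_X show ?thesis
      unfolding Let_def by blast
  next
    case True
    note R_sq = this
    then have X_sq: "second_moment M (X 1) < \<infinity>"
      using R_iff_X by blast
    \<comment> \<open>Profit is return minus bet, so the two ratios determine each other; equality
      across opportunities is then the same condition for both.\<close>
    have ha_rtp: "ha i = 1 - rtp i" for i
    proof -
      have "x $ i = expectation (\<lambda>\<omega>. R 1 \<omega> $ i - B 1 \<omega> $ i)"
        unfolding x_def mean_vec_def vec_lambda_beta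
        by (rule Bochner_Integration.integral_cong) (simp_all only: XB vector_minus_component)
      also have "\<dots> = r $ i - b $ i"
        unfolding r_def b_def mean_vec_def vec_lambda_beta
        by (rule Bochner_Integration.integral_diff[OF int[OF meas(2) R_sq] int[OF meas(1) B_sq]])
      finally show ?thesis
        using ha[of i] b_pos[of i] by (simp add: rtp field_simps)
    qed
    note R_asymp = cum_ratio_asymptotics[OF F \<beta> B B_sq R R_sq \<beta>_sq \<beta>_nonneg b_pos[unfolded b_def] liminf,
        folded b_def r_def, folded rtp]
    note X_asymp = cum_ratio_asymptotics[OF F \<beta> B B_sq X X_sq \<beta>_sq \<beta>_nonneg b_pos[unfolded b_def] liminf,
        folded b_def x_def, folded ha]
    have rtp_bounds: "(MIN i. rtp i) \<le> rtp j" "rtp j \<le> (MAX i. rtp i)"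
      and ha_bounds: "- (MAX i. ha i) \<le> - ha j" "- ha j \<le> - (MIN i. ha i)" for j
      by simp_all
    note R_asymp(1)[OF rtp_bounds] X_asymp(1)[OF ha_bounds]
    moreover have "(\<forall>i j. rtp i = rtp j) \<longleftrightarrow> (\<forall>i j. ha i = ha j)"
      by (simp add: ha_rtp)
    moreover have "(AE \<omega> in M. (\<lambda>n. cum_ratio (\<lambda>k \<omega>. Bbase k \<omega> \<bullet> R k \<omega>) (\<lambda>k \<omega>. Bbase k \<omega> \<bullet> B k \<omega>) n \<omega>) \<longlonglongrightarrow> rtp i) \<and> (AE \<omega> in M. (\<lambda>n. cum_ratio (\<lambda>k \<omega>. Bbase k \<omega> \<bullet> X k \<omega>) (\<lambda>k \<omega>. Bbase k \<omega> \<bullet> B k \<omega>) n \<omega>) \<longlonglongrightarrow> - ha i)"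
      if eq: "\<forall>i j. rtp i = rtp j" for i
    proof
      \<comment> \<open>With the common value as lower and as upper bound, the chain squeezes the
        lower and the upper limit together.\<close>
      have eqs: "rtp i \<le> rtp j" "rtp j \<le> rtp i" "- ha i \<le> - ha j" "- ha j \<le> - ha i" for j
        using eq[rule_format, of i j] unfolding ha_rtp by simp_all
      show "AE \<omega> in M. (\<lambda>n. cum_ratio (\<lambda>k \<omega>. Bbase k \<omega> \<bullet> R k \<omega>) (\<lambda>k \<omega>. Bbase k \<omega> \<bullet> B k \<omega>) n \<omega>) \<longlonglongrightarrow> rtp i"
        using R_asymp(1)[OF eqs(1,2)] by eventually_elim (rule limsup_le_liminf_real, auto)
      show "AE \<omega> in M. (\<lambda>n. cum_ratio (\<lambda>k \<omega>. Bbase k \<omega> \<bullet> X k \<omega>) (\<lambda>k \<omega>. Bbase k \<omega> \<bullet> B k \<omega>) n \<omega>) \<longlonglongrightarrow> - ha i"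
        using X_asymp(1)[OF eqs(3,4)] by eventually_elim (rule limsup_le_liminf_real, auto)
    qed
    moreover note R_asymp(2)[unfolded weighted] X_asymp(2)[unfolded weighted minus_divide_left[symmetric]]
    ultimately show ?thesis
      unfolding Let_def rtp_def[symmetric] ha_def[symmetric]
        b_def[symmetric] r_def[symmetric] x_def[symmetric] mb
      using R_iff_X R_sq by blast
  qed
qed

end
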